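(* Let $n\ge 0$ and let $(k_0,\ldots,k_r)$ be a finite vector of nonnegative integers satisfying $2r+k_0+k_1+\cdots+k_r=n$. Then the coefficient of $c^{k_0}dc^{k_1}d\cdots c^{k_{r-1}}dc^{k_r}$ in $\mathcal{I}_2(c^n)$, written as a polynomial in the noncommuting variables $c=a+b$ and $d=ab+ba$, is $2^{r+1}(k_0+1)(k_1+1)\cdots(k_r+1)$.
   Context: $\mathbb{Q}\langle a,b\rangle$ is the free associative algebra on noncommuting variables $a,b$, with basis all $ab$-words, including the empty word $1$. The map $u\mapsto u^*$ is the linear map reversing each word: $(u_1\cdots u_n)^*=u_n\cdots u_1$. The coproduct $\Delta$ is the linear map with $\Delta(u)=\sum_{i=1}^n u_1\cdots u_{i-1}\otimes u_{i+1}\cdots u_n$ for an $ab$-word $u=u_1\cdots u_n$ (so $\Delta(1)=0$), written in Sweedler notation as $\Delta(u)=\sum_u u_{(1)}\otimes u_{(2)}$. The mixing operator $M$ is the bilinear operator on $\mathbb{Q}\langle a,b\rangle$ given by $$M(u,v)=\sum_{r=1}^2\sum_{s=1}^2\ \sum_{n\ge 2,\ n-r-s-1\text{ even}}M_{r,s,n}(u,v),$$ where the bilinear operators $M_{r,s,n}$ (needed only for $n-r-s-1$ even) are defined recursively by $M_{1,2,2}(u,v)=u\cdot a\cdot v$, $M_{2,1,2}(u,v)=v\cdot b\cdot u$, and for $n\ge 2$: $M_{1,s,n+1}(u,v)=\sum_u u_{(1)}\cdot a\cdot M_{2,s,n}(u_{(2)},v)$ and $M_{2,s,n+1}(u,v)=\sum_v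 v_{(1)}\cdot b\cdot M_{1,s,n}(u,v_{(2)})$. The linear operator $\mathcal{I}_2$ on $\mathbb{Q}\langle a,b\rangle$ (the interval transform of the second kind at the level of $ab$-indices) is given on $ab$-words by $\mathcal{I}_2(u)=u+u^*+\sum_u M(u_{(1)}^*,u_{(2)})$. The elements $c=a+b$ and $d=ab+ba$ are algebraically independent noncommuting elements, and $\mathcal{I}_2(c^n)$ is a polynomial in $c$ and $d$, so the coefficients are well defined. *)

theory Defs
  imports Complex_Main "HOL-Library.Poly_Mapping"
begin

text \<open>
  The free associative algebra over the rationals on a set of letters is the monoid algebra
  of the free monoid of lists under concatenation.  Making lists an instance of
  \<^class>\<open>monoid_add\<close> (written additively, but not commutative) turns the convolution
  product of \<^theory>\<open>HOL-Library.Poly_Mapping\<close> into the concatenation product of this algebra.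
\<close>

instantiation list :: (type) monoid_add
begin

definition zero_list :: "'a list" where "zero_list = []"

definition plus_list :: "'a list \<Rightarrow> 'a list \<Rightarrow> 'a list" where "plus_list xs ys = xs @ ys"

instance by standard (simp_all add: zero_list_def plus_list_def)

end

type_synonym 'x free_alg = "'x list \<Rightarrow>\<^sub>0 rat"

definition of_word :: "'x list \<Rightarrow> 'x free_alg" where
  "of_word w = Poly_Mapping.single w 1"

text \<open>Linear extension of a map defined on a basis; \<open>Poly_Mapping.single 0 q\<close> is the scalar \<open>q\<close>.\<close>

definition lin_ext :: "('k \<Rightarrow> 'x free_alg) \<Rightarrow> ('k \<Rightarrow>\<^sub>0 rat) \<Rightarrow> 'x free_alg" where
  "lin_ext f p = (\<Sum>k\<in>Poly_Mapping.keys p. Poly_Mapping.single 0 (Poly_Mapping.lookup p k) * f k)"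

datatype ab = LA | LB

type_synonym ab_alg = "ab free_alg"

definition var_a :: ab_alg where "var_a = of_word [LA]"

definition var_b :: ab_alg where "var_b = of_word [LB]"

definition c_elt :: ab_alg where "c_elt = var_a + var_b"

definition d_elt :: ab_alg where "d_elt = var_a * var_b + var_b * var_a"

definition star :: "ab_alg \<Rightarrow> ab_alg" where
  "star = lin_ext (\<lambda>w. of_word (rev w))"

text \<open>
  The tensor square of the algebra has the pairs of words as a basis and is represented by
  finitely supported functions on pairs.  The sum below is indexed from 0, so its \<open>i\<close>-th term
  deletes the letter \<open>w ! i\<close>.
\<close>

definition coprod_word :: "'x list \<Rightarrow> ('x list \<times> 'x list) \<Rightarrow>\<^sub>0 rat" where
  "coprod_word w = (\<Sum>i<length w. Poly_Mapping.single (take i w, drop (Suc i) w) 1)"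

definition coprod :: "'x free_alg \<Rightarrow> ('x list \<times> 'x list) \<Rightarrow>\<^sub>0 rat" where
  "coprod u = (\<Sum>w\<in>Poly_Mapping.keys u.
     Poly_Mapping.map ((*) (Poly_Mapping.lookup u w)) (coprod_word w))"

text \<open>\<open>sweedler B u\<close> is the Sweedler sum over \<open>\<Delta>(u)\<close> of \<open>B u\<^sub>1 u\<^sub>2\<close>, for bilinear \<open>B\<close>.\<close>

definition sweedler :: "('x free_alg \<Rightarrow> 'x free_alg \<Rightarrow> 'y free_alg) \<Rightarrow> 'x free_alg \<Rightarrow> 'y free_alg" where
  "sweedler B u = lin_ext (\<lambda>(x, y). B (of_word x) (of_word y)) (coprod u)"

text \<open>
  \<open>mix_rsn r s n\<close> is \<open>M\<^sub>r\<^sub>,\<^sub>s\<^sub>,\<^sub>n\<close>, for \<open>r\<close> and \<open>s\<close> in \<open>{1, 2}\<close> and \<open>n \<ge> 2\<close>.  The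
  recursion changes the parities of \<open>n\<close> and \<open>r\<close> simultaneously, so the value 0 given to
  \<open>n = 2\<close>, \<open>r = s\<close> is never reached from indices with \<open>n - r - s - 1\<close> even.
\<close>

fun mix_rsn :: "nat \<Rightarrow> nat \<Rightarrow> nat \<Rightarrow> ab_alg \<Rightarrow> ab_alg \<Rightarrow> ab_alg" where
  "mix_rsn r s n u v =
    (if n = 2 then
       (if r = 1 \<and> s = 2 then u * var_a * v
        else if r = 2 \<and> s = 1 then v * var_b * u
        else 0)
     else if n > 2 then
       (if r = 1 then sweedler (\<lambda>u1 u2. u1 * var_a * mix_rsn 2 s (n - 1) u2 v) u
        else if r = 2 then sweedler (\<lambda>v1 v2. v1 * var_b * mix_rsn 1 s (n - 1) u v2) v
        else 0)
     else 0)"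

declare mix_rsn.simps [simp del]

text \<open>
  For given \<open>u\<close> and \<open>v\<close> only finitely many summands are nonzero (see \<open>finite_mix_rsn\<close> below), so
  \<^const>\<open>Sum_any\<close>, the sum over the support, is the intended infinite sum.
\<close>

definition mix :: "ab_alg \<Rightarrow> ab_alg \<Rightarrow> ab_alg" where
  "mix u v = (\<Sum>r\<in>{1, 2}. \<Sum>s\<in>{1, 2}.
     Sum_any (\<lambda>n. mix_rsn r s n u v when 2 \<le> n \<and> even (int n - int r - int s - 1)))"

definition interval2 :: "ab_alg \<Rightarrow> ab_alg" where
  "interval2 = lin_ext (\<lambda>w. of_word w + star (of_word w)
     + sweedler (\<lambda>u1 u2. mix (star u1) u2) (of_word w))"

datatype cd = LC | LD

text \<open>Substitution of \<open>a + b\<close> and \<open>ab + ba\<close> into a polynomial in two noncommuting variables.\<close>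

definition cd_eval :: "cd free_alg \<Rightarrow> ab_alg" where
  "cd_eval = lin_ext (\<lambda>w. prod_list (map (case_cd c_elt d_elt) w))"

definition cd_word :: "nat \<Rightarrow> (nat \<Rightarrow> nat) \<Rightarrow> cd list" where
  "cd_word r k = replicate (k 0) LC @ concat (map (\<lambda>i. LD # replicate (k i) LC) [1..<Suc r])"

lemma lookup_coprod:
  "Poly_Mapping.lookup (coprod u) xy =
     (\<Sum>w\<in>Poly_Mapping.keys u. Poly_Mapping.lookup u w * Poly_Mapping.lookup (coprod_word w) xy)"
  by (auto simp: coprod_def lookup_sum Poly_Mapping.map.rep_eq when_def intro!: sum.cong)

lemma keys_coprod:
  assumes "(x, y) \<in> Poly_Mapping.keys (coprod u)"
  obtains w where "w \<in> Poly_Mapping.keys u" "length y < length w"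
proof -
  from assms obtain w where w: "w \<in> Poly_Mapping.keys u"
      and nz: "Poly_Mapping.lookup (coprod_word w) (x, y) \<noteq> 0"
    unfolding in_keys_iff[of "(x, y)"] lookup_coprod
    by (metis (mono_tags, lifting) mult_zero_right sum.neutral)
  have "\<exists>i<length w. take i w = x \<and> drop (Suc i) w = y"
  proof (rule ccontr)
    assume "\<not> ?thesis"
    then have "Poly_Mapping.lookup (coprod_word w) (x, y) = 0"
      unfolding coprod_word_def lookup_sum lookup_single when_def by (intro sum.neutral) auto
    with nz show False by simp
  qed
  with w that show ?thesis by auto
qed

lemma mix_rsn_eq_0:
  assumes "\<forall>w\<in>Poly_Mapping.keys u. length w \<le> p"
    and "\<forall>w\<in>Poly_Mapping.keys v. length w \<le> q" and "p + q + 2 < n"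
  shows "mix_rsn r s n u v = 0"
  using assms
proof (induction n arbitrary: r u v p q)
  case 0
  then show ?case by simp
next
  case (Suc n)
  have *: "mix_rsn 2 s n (of_word y) v = 0"
    if xy: "(x, y) \<in> Poly_Mapping.keys (coprod u)" for x y
  proof -
    from keys_coprod[OF xy] Suc.prems(1) have "length y < p" by fastforce
    with Suc.prems show ?thesis
      by (intro Suc.IH[of _ "p - 1" _ q]) (auto simp: of_word_def)
  qed
  have **: "mix_rsn 1 s n u (of_word y) = 0"
    if xy: "(x, y) \<in> Poly_Mapping.keys (coprod v)" for x y
  proof -
    from keys_coprod[OF xy] Suc.prems(2) have "length y < q" by fastforce
    with Suc.prems show ?thesis
      by (intro Suc.IH[of _ p _ "q - 1"]) (auto simp: of_word_def)
  qed
  have "sweedler (\<lambda>u1 u2. u1 * var_a * mix_rsn 2 s n u2 v) u = 0"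
    unfolding sweedler_def lin_ext_def by (rule sum.neutral) (auto simp: *)
  moreover have "sweedler (\<lambda>v1 v2. v1 * var_b * mix_rsn 1 s n u v2) v = 0"
    unfolding sweedler_def lin_ext_def by (rule sum.neutral) (auto simp: **[simplified])
  ultimately show ?case using Suc.prems(3)
    by (subst mix_rsn.simps) (simp del: One_nat_def)
qed

lemma finite_mix_rsn: "finite {n. mix_rsn r s n u v \<noteq> 0}"
proof -
  define p q where "p = Max (insert 0 (length ` Poly_Mapping.keys u))"
    and "q = Max (insert 0 (length ` Poly_Mapping.keys v))"
  have "mix_rsn r s n u v = 0" if "p + q + 2 < n" for n
    using that by (intro mix_rsn_eq_0[of _ p _ q]) (auto simp: p_def q_def)
  then have "{n. mix_rsn r s n u v \<noteq> 0} \<subseteq> {..p + q + 2}"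
    by (force simp: not_less[symmetric])
  then show ?thesis by (rule finite_subset) simp
qed

end

theory Submission
  imports Defs
begin

text \<open>
  On powers of \<open>c\<close> the operator \<open>\<I>\<^sub>2\<close> yields sums of products
  \<open>c\<^sup>i x c\<^sup>j y c\<^sup>k \<dots>\<close> in which the separating letters alternate between \<open>a\<close> and \<open>b\<close>,
  each letter with weight \<open>2\<close>.  Let \<open>P\<close> and \<open>Q\<close> be the
  generating series of the products whose letters start with \<open>a\<close> and with \<open>b\<close>, both including
  the pure powers of \<open>c\<close>.  Then \<open>P = 1 + c P + 2 a Q\<close> and \<open>Q = 1 + c Q + 2 b P\<close>, and
  eliminating \<open>P - Q\<close> gives \<open>(1 - 2 c + c\<^sup>2 - 2 d) (P + Q) = 2\<close>.  Hence
  \<open>P + Q\<close> is the sum over \<open>r\<close> of \<open>2 C (2 d C)\<^sup>r\<close> with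
  \<open>C = (1 - c)\<^sup>-\<^sup>2\<close>, the sum of the \<open>(k + 1) c\<^sup>k\<close>.
\<close>

subsection \<open>Linear extensions\<close>

text \<open>Updating at a fresh key amounts to adding a monomial, so an additive identity needs
  checking on monomials only.\<close>

lemma poly_mapping_additive_induct [case_names zero single add]:
  fixes p :: "'k \<Rightarrow>\<^sub>0 'v::comm_monoid_add"
  assumes "P 0" and single: "\<And>k q. P (Poly_Mapping.single k q)"
    and add: "\<And>p q. P p \<Longrightarrow> P q \<Longrightarrow> P (p + q)"
  shows "P p"
proof (induction p rule: update_induct)
  case const
  show ?case by fact
next
  case (update f a b)
  then have "Poly_Mapping.update a b f = f + Poly_Mapping.single a b"
    by (intro poly_mapping_eqI) (auto simp: lookup_update lookup_add lookup_single in_keys_iff when_def)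
  with update.IH show ?case by (simp add: add single)
qed

text \<open>Scalars are central in the noncommutative algebra. This moves a factor past the
  coefficients that \<open>lin_ext\<close> puts on the left.\<close>

lemma single_zero_commute:
  fixes p :: "'x free_alg"
  shows "p * Poly_Mapping.single 0 q = Poly_Mapping.single 0 q * p"
  by (induction p rule: poly_mapping_additive_induct)
    (simp_all add: mult_single mult.commute distrib_left distrib_right)

lemma lin_ext_superset:
  assumes "finite A" "Poly_Mapping.keys p \<subseteq> A"
  shows "lin_ext f p = (\<Sum>k\<in>A. Poly_Mapping.single 0 (Poly_Mapping.lookup p k) * f k)"
  unfolding lin_ext_def using assms
  by (intro sum.mono_neutral_left) (auto simp: in_keys_iff)

lemma lin_ext_zero [simp]: "lin_ext f 0 = 0"
  by (simp add: lin_ext_def)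

lemma lin_ext_add: "lin_ext f (p + q) = lin_ext f p + lin_ext f q"
proof -
  let ?A = "Poly_Mapping.keys p \<union> Poly_Mapping.keys q"
  have "Poly_Mapping.keys (p + q) \<subseteq> ?A" by (rule keys_add)
  then show ?thesis
    by (simp add: lin_ext_superset[of ?A] lookup_add single_add distrib_right sum.distrib)
qed

lemma lin_ext_sum: "lin_ext f (\<Sum>i\<in>I. p i) = (\<Sum>i\<in>I. lin_ext f (p i))"
  by (induction I rule: infinite_finite_induct) (simp_all add: lin_ext_add)

lemma lin_ext_single: "lin_ext f (Poly_Mapping.single k q) = Poly_Mapping.single 0 q * f k"
  by (subst lin_ext_superset[of "{k}"]) auto

lemma lin_ext_of_word: "lin_ext f (of_word w) = f w"
  by (simp add: of_word_def lin_ext_single)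

lemma lin_ext_add_fun: "lin_ext (\<lambda>k. f k + g k) p = lin_ext f p + lin_ext g p"
  by (simp add: lin_ext_def distrib_left sum.distrib)

lemma star_of_word: "star (of_word w) = of_word (rev w)"
  by (simp add: star_def lin_ext_of_word)

subsection \<open>Algebraic independence of c and d\<close>

lemma lookup_of_word_mult_Cons:
  "Poly_Mapping.lookup (of_word [x] * p) (y # w) = (Poly_Mapping.lookup p w when x = y)"
  by (induction p rule: poly_mapping_additive_induct)
    (auto simp: of_word_def mult_single lookup_single lookup_add distrib_left plus_list_def when_def)

lemma lookup_of_word_mult_Nil: "Poly_Mapping.lookup (of_word [x] * p) [] = 0"
  by (induction p rule: poly_mapping_additive_induct)
    (auto simp: of_word_def mult_single lookup_single lookup_add distrib_left plus_list_def when_def)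

lemmas lookup_of_word_mult = lookup_of_word_mult_Cons lookup_of_word_mult_Nil

lemma cd_eval_add: "cd_eval (p + q) = cd_eval p + cd_eval q"
  by (simp add: cd_eval_def lin_ext_add)

lemma cd_eval_diff: "cd_eval (p - q) = cd_eval p - cd_eval q"
  using cd_eval_add[of "p - q" q] by (simp add: algebra_simps)

lemma cd_eval_scalar: "cd_eval (Poly_Mapping.single 0 q) = Poly_Mapping.single 0 q"
  by (simp add: cd_eval_def lin_ext_single zero_list_def)

lemma cd_eval_of_word_mult: "cd_eval (of_word [x] * p) = case_cd c_elt d_elt x * cd_eval p"
proof (induction p rule: poly_mapping_additive_induct)
  case (single k q)
  have "cd_eval (of_word [x] * Poly_Mapping.single k q) =
      Poly_Mapping.single 0 q * case_cd c_elt d_elt x * prod_list (map (case_cd c_elt d_elt) k)"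
    by (simp add: cd_eval_def of_word_def mult_single lin_ext_single plus_list_def mult.assoc)
  also have "\<dots> = case_cd c_elt d_elt x * cd_eval (Poly_Mapping.single k q)"
    unfolding single_zero_commute[symmetric] by (simp add: cd_eval_def lin_ext_single mult.assoc)
  finally show ?case .
qed (simp_all add: cd_eval_add distrib_left, simp add: cd_eval_def)

lemma var_a_mult_eq_var_b_mult:
  assumes "var_b * p = var_a * p"
  shows "p = 0"
proof (rule poly_mapping_eqI)
  fix w
  have "Poly_Mapping.lookup (var_b * p) (LA # w) = Poly_Mapping.lookup (var_a * p) (LA # w)"
    by (simp add: assms)
  then show "Poly_Mapping.lookup p w = Poly_Mapping.lookup 0 w"
    by (simp add: var_a_def var_b_def lookup_of_word_mult)
qed

text \<open>By freeness, the algebra is the direct sum of the scalars and the right ideals generated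
  by a and by b, and left multiplication by a letter is injective.\<close>

lemma ab_decomp_eq_0:
  assumes "Poly_Mapping.single 0 q + var_a * p1 + var_b * p2 = 0"
  shows "q = 0" "p1 = 0" "p2 = 0"
proof -
  have *: "Poly_Mapping.lookup (Poly_Mapping.single 0 q + var_a * p1 + var_b * p2) w = 0" for w
    by (simp add: assms)
  show "q = 0"
    using *[of "[]"] by (simp add: lookup_add lookup_single var_a_def var_b_def
        lookup_of_word_mult zero_list_def)
  show "p1 = 0"
    using *[of "LA # _"] by (intro poly_mapping_eqI)
      (simp add: lookup_add lookup_single var_a_def var_b_def lookup_of_word_mult zero_list_def)
  show "p2 = 0"
    using *[of "LB # _"] by (intro poly_mapping_eqI)
      (simp add: lookup_add lookup_single var_a_def var_b_def lookup_of_word_mult zero_list_def)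
qed

text \<open>Sorts the words by first letter: \<open>map_key (Cons x)\<close> keeps those that start
  with \<open>x\<close> and strips that letter.\<close>

lemma cd_decomp:
  "p = Poly_Mapping.single 0 (Poly_Mapping.lookup p []) + of_word [LC] * Poly_Mapping.map_key (Cons LC) p
     + of_word [LD] * Poly_Mapping.map_key (Cons LD) p"
proof (rule poly_mapping_eqI)
  fix w :: "cd list"
  show "Poly_Mapping.lookup p w = Poly_Mapping.lookup
    (Poly_Mapping.single 0 (Poly_Mapping.lookup p []) + of_word [LC] * Poly_Mapping.map_key (Cons LC) p
     + of_word [LD] * Poly_Mapping.map_key (Cons LD) p) w"
  proof (cases w)
    case (Cons x v)
    then show ?thesis
      by (cases x) (simp_all add: lookup_add lookup_single lookup_of_word_mult zero_list_def
          map_key.rep_eq)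
  qed (simp add: lookup_add lookup_single lookup_of_word_mult zero_list_def)
qed

text \<open>Induction on a bound for the word lengths. Since cP + dQ = a(P + bQ) + b(P + aQ), its
  vanishing forces bQ = aQ, hence Q = 0 and then P = 0.\<close>

lemma cd_eval_eq_0:
  assumes "cd_eval p = 0"
  shows "p = 0"
proof -
  have "p = 0" if "\<forall>w\<in>Poly_Mapping.keys p. length w < N" "cd_eval p = 0" for N
    using that
  proof (induction N arbitrary: p)
    case 0
    then show ?case by (simp flip: keys_eq_empty)
  next
    case (Suc N)
    define pc pd where "pc = Poly_Mapping.map_key (Cons LC) p" and "pd = Poly_Mapping.map_key (Cons LD) p"
    define q where "q = Poly_Mapping.lookup p []"
    have p: "p = Poly_Mapping.single 0 q + of_word [LC] * pc + of_word [LD] * pd"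
      unfolding pc_def pd_def q_def by (rule cd_decomp)
    have small: "\<forall>w\<in>Poly_Mapping.keys pc. length w < N" "\<forall>w\<in>Poly_Mapping.keys pd. length w < N"
      using Suc.prems(1) by (fastforce simp: pc_def pd_def keys_map_key)+
    have "Poly_Mapping.single 0 q + c_elt * cd_eval pc + d_elt * cd_eval pd = 0"
      using Suc.prems(2) p by (simp add: cd_eval_add cd_eval_scalar cd_eval_of_word_mult)
    then have "Poly_Mapping.single 0 q + var_a * (cd_eval pc + var_b * cd_eval pd)
        + var_b * (cd_eval pc + var_a * cd_eval pd) = 0"
      by (simp add: c_elt_def d_elt_def algebra_simps)
    note eqs = ab_decomp_eq_0[OF this]
    from eqs(2,3) have "var_b * cd_eval pd = var_a * cd_eval pd"
      by (metis add_left_cancel)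
    then have pd: "cd_eval pd = 0" by (rule var_a_mult_eq_var_b_mult)
    with eqs(2) have "cd_eval pc = 0" by simp
    with pd small have "pc = 0" "pd = 0" by (auto intro: Suc.IH)
    with p eqs(1) show ?case by simp
  qed
  \<comment> \<open>For \<open>p = 0\<close> the maximum is unspecified, but the claim is then
    vacuous.\<close>
  moreover have "\<forall>w\<in>Poly_Mapping.keys p. length w < Suc (Max (length ` Poly_Mapping.keys p))"
    by (simp add: less_Suc_eq_le)
  ultimately show ?thesis using assms by blast
qed

lemma cd_eval_inject: "cd_eval p = cd_eval q \<longleftrightarrow> p = q"
  using cd_eval_eq_0[of "p - q"] by (auto simp: cd_eval_diff)

subsection \<open>The recurrence for the cd-index\<close>

text \<open>
  With \<open>e = a - b\<close> one has \<open>2d - c\<^sup>2 = - e\<^sup>2\<close>, so this is the recurrence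
  of the coefficients of \<open>2 / (1 - 2c + e\<^sup>2)\<close>.
\<close>

fun cd_index :: "nat \<Rightarrow> cd free_alg" where
  "cd_index 0 = 2"
| "cd_index (Suc 0) = of_word [LC] * 4"
| "cd_index (Suc (Suc n)) = of_word [LC] * (cd_index (Suc n) + cd_index (Suc n))
     + of_word [LD] * (cd_index n + cd_index n) - of_word [LC] * (of_word [LC] * cd_index n)"

lemma cd_word_0: "cd_word 0 k = replicate (k 0) LC"
  by (simp add: cd_word_def)

lemma cd_word_Suc:
  "cd_word (Suc r) k = replicate (k 0) LC @ LD # cd_word r (\<lambda>i. k (Suc i))"
proof -
  have "[1..<Suc (Suc r)] = 1 # map Suc [1..<Suc r]"
    by (simp add: map_Suc_upt upt_conv_Cons del: upt_Suc)
  then show ?thesis by (simp add: cd_word_def o_def del: upt_Suc)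
qed

lemma cd_word_Cons:
  assumes "k 0 = Suc m"
  shows "cd_word r k = LC # cd_word r (k(0 := m))"
  using assms by (cases r) (simp_all add: cd_word_0 cd_word_Suc)

lemma prod_fun_upd_0:
  fixes k :: "nat \<Rightarrow> nat"
  shows "(\<Prod>i\<le>r. rat_of_nat ((k(0 := m)) i + 1)) = (of_nat m + 1) * (\<Prod>i=1..r. of_nat (k i + 1))"
  by (simp add: atMost_atLeast0 prod.atLeast_Suc_atMost algebra_simps)

text \<open>A word starting with d sees only the doubled d-term of the recurrence. For a word
  starting with c, the factor \<open>k 0 + 1\<close> is linear in \<open>k 0\<close>, and m + 2 =
  2(m + 1) - m is exactly what the c-terms require.\<close>

lemma lookup_cd_index:
  assumes "2 * r + (\<Sum>i\<le>r. k i) = n"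
  shows "Poly_Mapping.lookup (cd_index n) (cd_word r k) = 2 ^ (r + 1) * (\<Prod>i\<le>r. of_nat (k i + 1))"
  using assms
proof (induction n arbitrary: r k rule: cd_index.induct)
  case 1
  then show ?case
    by (simp add: cd_word_0 zero_list_def lookup_numeral flip: zero_list_def)
next
  case 2
  then have "r = 0" "k 0 = 1" by (auto split: if_splits) (cases r; simp)
  then show ?case by (simp add: cd_word_0 lookup_of_word_mult lookup_numeral zero_list_def)
next
  case (3 n)
  show ?case
  proof (cases "k 0")
    case 0
    with "3.prems" obtain r' where r: "r = Suc r'" by (cases r) auto
    let ?k = "\<lambda>i. k (Suc i)"
    have "2 * r' + (\<Sum>i\<le>r'. ?k i) = n"
      using "3.prems" 0 by (simp add: r sum.atMost_Suc_shift del: sum.atMost_Suc)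
    from "3.IH"(3)[OF this] show ?thesis
      by (simp add: r 0 cd_word_Suc lookup_of_word_mult lookup_add lookup_minus
          prod.atMost_Suc_shift del: prod.atMost_Suc)
  next
    case (Suc m)
    let ?k = "k(0 := m)"
    let ?Q = "2 ^ (r + 1) * (\<Prod>i=1..r. rat_of_nat (k i + 1))"
    have goal: "2 ^ (r + 1) * (\<Prod>i\<le>r. rat_of_nat (k i + 1)) = (of_nat m + 2) * ?Q"
      using prod_fun_upd_0[of k "Suc m" r] Suc by (simp add: fun_upd_idem algebra_simps)
    have "2 * r + (\<Sum>i\<le>r. ?k i) = Suc n"
      using "3.prems" Suc by (simp add: atMost_atLeast0 sum.atLeast_Suc_atMost)
    from "3.IH"(1)[OF this]
    have 1: "Poly_Mapping.lookup (cd_index (Suc n)) (cd_word r ?k) = (of_nat m + 1) * ?Q"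
      unfolding prod_fun_upd_0 by (simp only: mult_ac)
    have 2: "Poly_Mapping.lookup (of_word [LC] * cd_index n) (cd_word r ?k) = of_nat m * ?Q"
    proof (cases m)
      \<comment> \<open>The word does not start with c, so the coefficient is 0, in agreement with
        the factor \<open>m\<close>.\<close>
      case 0
      then show ?thesis
        by (cases r) (simp_all add: cd_word_0 cd_word_Suc lookup_of_word_mult)
    next
      case (Suc l)
      have k0: "?k 0 = Suc l" using Suc by simp
      have "2 * r + (\<Sum>i\<le>r. (k(0 := l)) i) = n"
        using "3.prems" Suc \<open>k 0 = Suc m\<close> by (simp add: atMost_atLeast0 sum.atLeast_Suc_atMost)
      from "3.IH"(3)[OF this]
      have "Poly_Mapping.lookup (cd_index n) (cd_word r (k(0 := l))) = (of_nat l + 1) * ?Q"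
        unfolding prod_fun_upd_0 by (simp only: mult_ac)
      then show ?thesis
        using cd_word_Cons[where k = ?k and r = r, OF k0] by (simp add: lookup_of_word_mult Suc add.commute)
    qed
    show ?thesis unfolding goal cd_word_Cons[where k = k and r = r, OF Suc]
      by (simp add: lookup_of_word_mult lookup_add lookup_minus 1 2)
        (simp add: algebra_simps)
  qed
qed

subsection \<open>Biadditive operators on powers of c\<close>

definition words :: "nat \<Rightarrow> ab list set" where
  "words n = {w. length w = n}"

lemma words_0 [simp]: "words 0 = {[]}"
  by (auto simp: words_def)

lemma words_Suc: "words (Suc n) = Cons LA ` words n \<union> Cons LB ` words n"
proof -
  have "w \<in> Cons LA ` words n \<union> Cons LB ` words n" if "length w = Suc n" for w
  proof -
    from that obtain x v where "w = x # v" "length v = n" by (cases w) auto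
    then show ?thesis by (cases x) (auto simp: words_def)
  qed
  then show ?thesis by (auto simp: words_def)
qed

lemma finite_words [simp]: "finite (words n)"
  by (induction n) (simp_all add: words_Suc)

lemma sum_words_Suc:
  fixes f :: "ab list \<Rightarrow> 'v::comm_monoid_add"
  shows "(\<Sum>w\<in>words (Suc n). f w) = (\<Sum>w\<in>words n. f (LA # w)) + (\<Sum>w\<in>words n. f (LB # w))"
  unfolding words_Suc by (subst sum.union_disjoint) (auto simp: sum.reindex)

lemma sum_words_rev: "(\<Sum>w\<in>words n. f (rev w)) = (\<Sum>w\<in>words n. f w)"
  by (rule sum.reindex_bij_witness[of _ rev rev]) (auto simp: words_def)

text \<open>The deleted letter may be a or b, so every pair arises twice. This is the source of all
  weights 2.\<close>

lemma sum_words_split: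
  fixes g :: "ab list \<Rightarrow> ab list \<Rightarrow> 'v::comm_monoid_add"
  shows "(\<Sum>w\<in>words (i + Suc j). g (take i w) (drop (Suc i) w)) =
    (\<Sum>x\<in>words i. \<Sum>y\<in>words j. g x y) + (\<Sum>x\<in>words i. \<Sum>y\<in>words j. g x y)"
proof (induction i arbitrary: g)
  case 0
  show ?case by (simp add: sum_words_Suc)
next
  case (Suc i)
  show ?case
    using Suc[of "\<lambda>x. g (LA # x)"] Suc[of "\<lambda>x. g (LB # x)"]
    by (simp add: sum_words_Suc[of _ "i + Suc j"] sum_words_Suc[of _ i] del: add_Suc_right)
      (simp only: ac_simps)
qed

lemma c_power_eq_sum_words: "c_elt ^ n = (\<Sum>w\<in>words n. of_word w)"
proof (induction n)
  case 0
  show ?case by (simp add: of_word_def zero_list_def flip: single_one)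
next
  case (Suc n)
  have "(\<Sum>w\<in>words n. of_word (x # w)) = of_word [x] * (\<Sum>w\<in>words n. of_word w)" for x
    unfolding sum_distrib_left by (simp add: of_word_def mult_single plus_list_def)
  then show ?case
    by (simp add: sum_words_Suc c_elt_def distrib_right var_a_def var_b_def flip: Suc)
qed

text \<open>Plain additivity instead of bilinearity, because a power of c is a sum of words with
  coefficient 1.\<close>

definition biadditive :: "('u::comm_monoid_add \<Rightarrow> 'v::comm_monoid_add \<Rightarrow> 'w::ab_group_add) \<Rightarrow> bool" where
  "biadditive B \<longleftrightarrow> (\<forall>u u' v. B (u + u') v = B u v + B u' v) \<and> (\<forall>u v v'. B u (v + v') = B u v + B u v')"

lemma biadditive_sum:
  assumes "biadditive B"
  shows "B (\<Sum>x\<in>X. f x) (\<Sum>y\<in>Y. g y) = (\<Sum>x\<in>X. \<Sum>y\<in>Y. B (f x) (g y))"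
proof -
  have add: "B (u + u') v = B u v + B u' v" "B u (v + v') = B u v + B u v'" for u u' v v'
    using assms by (auto simp: biadditive_def)
  have zero: "B 0 v = 0" "B u 0 = 0" for u v
    using add(1)[of 0 0 v] add(2)[of u 0 0] by auto
  have 1: "B (\<Sum>x\<in>X. f x) v = (\<Sum>x\<in>X. B (f x) v)" for v
    by (induction X rule: infinite_finite_induct) (auto simp: zero add)
  have 2: "B u (\<Sum>y\<in>Y. g y) = (\<Sum>y\<in>Y. B u (g y))" for u
    by (induction Y rule: infinite_finite_induct) (auto simp: zero add)
  show ?thesis by (subst 1) (simp only: 2)
qed

lemma biadditive_sum_fun:
  assumes "\<And>i. i \<in> I \<Longrightarrow> biadditive (B i)"
  shows "biadditive (\<lambda>u v. \<Sum>i\<in>I. B i u v)"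
  using assms by (simp add: biadditive_def sum.distrib)

lemma biadditive_when: "biadditive B \<Longrightarrow> biadditive (\<lambda>u v. B u v when P)"
  by (cases P) (simp_all add: biadditive_def)

lemma biadditive_c_power:
  assumes "biadditive B"
  shows "(\<Sum>x\<in>words i. \<Sum>y\<in>words j. B (of_word x) (of_word y)) = B (c_elt ^ i) (c_elt ^ j)"
  unfolding c_power_eq_sum_words biadditive_sum[OF assms] ..

lemma coprod_add: "coprod (u + v) = coprod u + coprod v"
proof (rule poly_mapping_eqI)
  fix xy
  let ?A = "Poly_Mapping.keys u \<union> Poly_Mapping.keys v"
  have *: "Poly_Mapping.lookup (coprod p) xy =
      (\<Sum>w\<in>?A. Poly_Mapping.lookup p w * Poly_Mapping.lookup (coprod_word w) xy)"
    if "Poly_Mapping.keys p \<subseteq> ?A" for p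
    unfolding lookup_coprod using that by (intro sum.mono_neutral_left) (auto simp: in_keys_iff)
  show "Poly_Mapping.lookup (coprod (u + v)) xy = Poly_Mapping.lookup (coprod u + coprod v) xy"
    using keys_add[of u v] by (simp add: * lookup_add distrib_right sum.distrib)
qed

lemma sweedler_add: "sweedler B (u + v) = sweedler B u + sweedler B v"
  by (simp add: sweedler_def coprod_add lin_ext_add)

lemma sweedler_sum: "sweedler B (\<Sum>i\<in>I. u i) = (\<Sum>i\<in>I. sweedler B (u i))"
proof -
  have "sweedler B 0 = 0" by (simp add: sweedler_def coprod_def)
  then show ?thesis
    by (induction I rule: infinite_finite_induct) (simp_all add: sweedler_add)
qed

lemma sweedler_add_fun: "sweedler (\<lambda>x y. B x y + B' x y) u = sweedler B u + sweedler B' u"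
  by (simp add: sweedler_def split_def lin_ext_add_fun)

lemma sweedler_zero_fun: "sweedler (\<lambda>x y. 0) u = 0"
  by (simp add: sweedler_def lin_ext_def split_def)

lemma sweedler_sum_fun: "sweedler (\<lambda>x y. \<Sum>i\<in>I. B i x y) u = (\<Sum>i\<in>I. sweedler (B i) u)"
  by (induction I rule: infinite_finite_induct) (simp_all add: sweedler_zero_fun sweedler_add_fun)

lemma sweedler_of_word:
  "sweedler B (of_word w) = (\<Sum>i<length w. B (of_word (take i w)) (of_word (drop (Suc i) w)))"
proof -
  have "coprod (of_word w) = coprod_word w"
    by (rule poly_mapping_eqI) (simp add: lookup_coprod of_word_def)
  then show ?thesis
    by (simp add: sweedler_def coprod_word_def lin_ext_sum lin_ext_single)
qed

lemma sum_words_deletion: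
  fixes g :: "ab list \<Rightarrow> ab list \<Rightarrow> 'v::comm_monoid_add"
  shows "(\<Sum>w\<in>words n. \<Sum>i<length w. g (take i w) (drop (Suc i) w)) =
    (\<Sum>i<n. (\<Sum>x\<in>words i. \<Sum>y\<in>words (n - Suc i). g x y) + (\<Sum>x\<in>words i. \<Sum>y\<in>words (n - Suc i). g x y))"
proof -
  have "(\<Sum>w\<in>words n. \<Sum>i<length w. g (take i w) (drop (Suc i) w)) =
      (\<Sum>w\<in>words n. \<Sum>i<n. g (take i w) (drop (Suc i) w))"
    by (rule sum.cong) (simp_all add: words_def)
  also have "\<dots> = (\<Sum>i<n. \<Sum>w\<in>words n. g (take i w) (drop (Suc i) w))"
    by (rule sum.swap)
  also have "\<dots> = (\<Sum>i<n. (\<Sum>x\<in>words i. \<Sum>y\<in>words (n - Suc i). g x y)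
      + (\<Sum>x\<in>words i. \<Sum>y\<in>words (n - Suc i). g x y))"
  proof (rule sum.cong[OF refl])
    fix i assume "i \<in> {..<n}"
    then have "i + Suc (n - Suc i) = n" by simp
    then show "(\<Sum>w\<in>words n. g (take i w) (drop (Suc i) w)) =
      (\<Sum>x\<in>words i. \<Sum>y\<in>words (n - Suc i). g x y) + (\<Sum>x\<in>words i. \<Sum>y\<in>words (n - Suc i). g x y)"
      using sum_words_split[where i = i and j = "n - Suc i" and g = g] by simp
  qed
  finally show ?thesis .
qed

text \<open>The coproduct of a power of c is twice the sum of its splittings into two powers of c;
  the factor 2 appears as a repeated summand.\<close>

lemma sweedler_c_power:
  assumes "biadditive B"
  shows "sweedler B (c_elt ^ n) =
    (\<Sum>i<n. B (c_elt ^ i) (c_elt ^ (n - Suc i)) + B (c_elt ^ i) (c_elt ^ (n - Suc i)))"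
  by (simp add: c_power_eq_sum_words[of n] sweedler_sum sweedler_of_word
      sum_words_deletion[of "\<lambda>x y. B (of_word x) (of_word y)"] biadditive_c_power[OF assms])

subsection \<open>The mixing operator on powers of c\<close>

lemma mix_rsn_Suc:
  assumes "n \<ge> 2"
  shows "mix_rsn 1 s (Suc n) u v = sweedler (\<lambda>u1 u2. u1 * var_a * mix_rsn 2 s n u2 v) u"
    and "mix_rsn 2 s (Suc n) u v = sweedler (\<lambda>v1 v2. v1 * var_b * mix_rsn 1 s n u v2) v"
  using assms by (simp_all add: mix_rsn.simps[of _ _ "Suc n"] del: One_nat_def)

lemma mix_rsn_two:
  "mix_rsn 1 2 2 u v = u * var_a * v" "mix_rsn 2 1 2 u v = v * var_b * u"
  by (simp_all add: mix_rsn.simps)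

text \<open>In the argument that is split, additivity comes from the coproduct; in the other one it
  comes from the induction hypothesis, where \<open>r\<close> has switched.\<close>

lemma biadditive_mix_rsn: "biadditive (mix_rsn r s n)"
proof (induction n arbitrary: r)
  case 0
  show ?case by (simp add: biadditive_def mix_rsn.simps)
next
  case (Suc n)
  consider "Suc n < 2" | "Suc n = 2" | "n \<ge> 2" "r = 1" | "n \<ge> 2" "r = 2"
    | "n \<ge> 2" "r \<noteq> 1" "r \<noteq> 2" by linarith
  then show ?case
  proof cases
    case 3
    with Suc[of 2] show ?thesis
      by (simp add: biadditive_def mix_rsn_Suc sweedler_add sweedler_add_fun distrib_left del: One_nat_def)
  next
    case 4
    with Suc[of 1] show ?thesis
      by (simp add: biadditive_def mix_rsn_Suc sweedler_add sweedler_add_fun distrib_left del: One_nat_def)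
  qed (auto simp: biadditive_def mix_rsn.simps algebra_simps)
qed

text \<open>The part of M with fixed \<open>r\<close>, cut off at \<open>n = N\<close>. The cutoff
  makes the sum finite for all arguments and serves as induction parameter.\<close>

definition mix_upto :: "nat \<Rightarrow> nat \<Rightarrow> ab_alg \<Rightarrow> ab_alg \<Rightarrow> ab_alg" where
  "mix_upto r N u v = (\<Sum>s\<in>{1, 2}. \<Sum>n\<in>{2..N}.
     mix_rsn r s n u v when even (int n - int r - int s - 1))"

lemma biadditive_mix_upto: "biadditive (mix_upto r N)"
  unfolding mix_upto_def by (intro biadditive_sum_fun biadditive_when biadditive_mix_rsn)

lemma mix_of_word:
  assumes "length x + length y + 2 \<le> N"
  shows "mix (of_word x) (of_word y) = mix_upto 1 N (of_word x) (of_word y) + mix_upto 2 N (of_word x) (of_word y)"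
proof -
  have 0: "mix_rsn r s n (of_word x) (of_word y) = 0" if "n > N" for r s n
    using assms that by (intro mix_rsn_eq_0[of _ "length x" _ "length y"]) (auto simp: of_word_def)
  have "Sum_any (\<lambda>n. mix_rsn r s n (of_word x) (of_word y) when 2 \<le> n \<and> even (int n - int r - int s - 1)) =
      (\<Sum>n\<in>{2..N}. mix_rsn r s n (of_word x) (of_word y) when even (int n - int r - int s - 1))" for r s
  proof (subst Sum_any.expand_superset[of "{2..N}"])
    show "{n. (mix_rsn r s n (of_word x) (of_word y) when 2 \<le> n \<and> even (int n - int r - int s - 1)) \<noteq> 0}
        \<subseteq> {2..N}"
      using 0 by (force simp: not_less[symmetric])
  qed (auto intro!: sum.cong simp: when_def)
  then show ?thesis by (simp add: mix_def mix_upto_def)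
qed

lemma mult_when: "w * (m when P) = (w * m when P)" for w :: "'a::mult_zero"
  by (simp add: when_def)

lemma sweedler_when: "sweedler (\<lambda>x y. B x y when P) u = (sweedler B u when P)"
  by (cases P) (simp_all add: sweedler_zero_fun)

text \<open>Among the terms with \<open>n = 2\<close>, parity admits only \<open>s = 2\<close> for
  \<open>r = 1\<close> and only \<open>s = 1\<close> for \<open>r = 2\<close>; they give the
  isolated product. Lowering \<open>n\<close> by one while switching \<open>r\<close> preserves the
  parity condition, so the other terms assemble into the other truncated sum.\<close>

lemma mix_upto_Suc:
  assumes "N \<ge> 1"
  shows "mix_upto 1 (Suc N) u v = u * var_a * v + sweedler (\<lambda>u1 u2. u1 * var_a * mix_upto 2 N u2 v) u"
    and "mix_upto 2 (Suc N) u v = v * var_b * u + sweedler (\<lambda>v1 v2. v1 * var_b * mix_upto 1 N u v2) v"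
proof -
  have shift: "(\<Sum>n\<in>{2..Suc N}. f n) = f 2 + (\<Sum>n\<in>{2..N}. f (Suc n))" for f :: "nat \<Rightarrow> ab_alg"
    using assms by (simp add: sum.atLeast_Suc_atMost sum.shift_bounds_cl_Suc_ivl numeral_2_eq_2
        del: sum.cl_ivl_Suc)
  have "sweedler (\<lambda>u1 u2. u1 * var_a * mix_upto 2 N u2 v) u =
      (\<Sum>s\<in>{1, 2}. \<Sum>n\<in>{2..N}. mix_rsn 1 s (Suc n) u v when even (int (Suc n) - int 1 - int s - 1))"
    unfolding mix_upto_def sum_distrib_left sweedler_sum_fun mult_when sweedler_when
    by (intro sum.cong refl when_cong) (auto simp: mix_rsn_Suc simp del: One_nat_def)
  then show "mix_upto 1 (Suc N) u v = u * var_a * v + sweedler (\<lambda>u1 u2. u1 * var_a * mix_upto 2 N u2 v) u"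
    by (simp add: mix_upto_def shift mix_rsn_two algebra_simps del: One_nat_def sum.cl_ivl_Suc)
  have "sweedler (\<lambda>v1 v2. v1 * var_b * mix_upto 1 N u v2) v =
      (\<Sum>s\<in>{1, 2}. \<Sum>n\<in>{2..N}. mix_rsn 2 s (Suc n) u v when even (int (Suc n) - int 2 - int s - 1))"
    unfolding mix_upto_def sum_distrib_left sweedler_sum_fun mult_when sweedler_when
    by (intro sum.cong refl when_cong) (auto simp: mix_rsn_Suc simp del: One_nat_def)
  then show "mix_upto 2 (Suc N) u v = v * var_b * u + sweedler (\<lambda>v1 v2. v1 * var_b * mix_upto 1 N u v2) v"
    by (simp add: mix_upto_def shift mix_rsn_two algebra_simps del: One_nat_def sum.cl_ivl_Suc)
qed

text \<open>
  The sum of the products \<open>c\<^sup>i x c\<^sup>j y c\<^sup>k x \<dots>\<close> whose exponents at odd positions are taken from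
  \<open>p\<close> and whose exponents at even positions are taken from \<open>q\<close>.  Each letter after the first
  uses up one unit and carries the weight \<open>2\<close>.
\<close>

function alternating :: "ab_alg \<Rightarrow> ab_alg \<Rightarrow> nat \<Rightarrow> nat \<Rightarrow> ab_alg" where
  "alternating x y 0 q = x * c_elt ^ q"
| "alternating x y (Suc p) q =
     c_elt * alternating x y p q + (x * alternating y x q p + x * alternating y x q p)"
  by pat_completeness auto
termination by (relation "measure (\<lambda>(x, y, p, q). p + q)") auto

text \<open>Sorts the products with at least two letters by the exponent \<open>i\<close> before the
  first letter, to match the Sweedler sums in \<open>mix_upto_Suc\<close>.\<close>

lemma alternating_eq_sum:
  "alternating x y p q = c_elt ^ p * x * c_elt ^ q +
     (\<Sum>i<p. c_elt ^ i * x * alternating y x q (p - Suc i) + c_elt ^ i * x * alternating y x q (p - Suc i))"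
  by (induction p)
    (simp_all add: sum.lessThan_Suc_shift sum_distrib_left algebra_simps del: sum.lessThan_Suc)

text \<open>Both claims need a joint induction, since each recursion step switches \<open>r\<close>.
  It also lowers an exponent, which keeps the bound valid for the smaller cutoff. For
  \<open>r = 2\<close> the exponents are swapped because these products begin with a part of
  \<open>v\<close>.\<close>

lemma mix_upto_c_power:
  assumes "p + q + 2 \<le> N"
  shows "mix_upto 1 N (c_elt ^ p) (c_elt ^ q) = alternating var_a var_b p q"
    and "mix_upto 2 N (c_elt ^ p) (c_elt ^ q) = alternating var_b var_a q p"
proof -
  have "mix_upto 1 N (c_elt ^ p) (c_elt ^ q) = alternating var_a var_b p q \<and>
      mix_upto 2 N (c_elt ^ p) (c_elt ^ q) = alternating var_b var_a q p"
    using assms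
  proof (induction N arbitrary: p q)
    case (Suc N)
    have 1: "biadditive (\<lambda>u1 u2. u1 * var_a * mix_upto 2 N u2 v)" for v
      using biadditive_mix_upto[of 2 N] by (simp add: biadditive_def algebra_simps)
    have 2: "biadditive (\<lambda>v1 v2. v1 * var_b * mix_upto 1 N u v2)" for u
      using biadditive_mix_upto[of 1 N] by (simp add: biadditive_def algebra_simps)
    have N: "N \<ge> 1" using Suc.prems by simp
    have "mix_upto 2 N (c_elt ^ (p - Suc i)) (c_elt ^ q) = alternating var_b var_a q (p - Suc i)"
      if "i < p" for i
      using Suc.IH[of "p - Suc i" q] Suc.prems that by simp
    moreover have "mix_upto 1 N (c_elt ^ p) (c_elt ^ (q - Suc i)) = alternating var_a var_b p (q - Suc i)"
      if "i < q" for i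
      using Suc.IH[of p "q - Suc i"] Suc.prems that by simp
    ultimately show ?case
      unfolding mix_upto_Suc[OF N] sweedler_c_power[OF 1] sweedler_c_power[OF 2]
        alternating_eq_sum[of var_a var_b p q] alternating_eq_sum[of var_b var_a q p]
      by (simp del: One_nat_def)
  qed simp
  then show "mix_upto 1 N (c_elt ^ p) (c_elt ^ q) = alternating var_a var_b p q"
    and "mix_upto 2 N (c_elt ^ p) (c_elt ^ q) = alternating var_b var_a q p" by auto
qed

subsection \<open>The recurrence for the ab-index\<close>

text \<open>The degree \<open>n\<close> part of the series P (for a, b) or Q (for b, a). The
  repeated summand gives the first letter the weight 2 that \<open>alternating\<close>
  omits.\<close>

definition alternating_total :: "ab_alg \<Rightarrow> ab_alg \<Rightarrow> nat \<Rightarrow> ab_alg" where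
  "alternating_total x y n = c_elt ^ n +
     (\<Sum>i<n. alternating x y i (n - Suc i) + alternating x y i (n - Suc i))"

lemma alternating_total_0: "alternating_total x y 0 = 1"
  by (simp add: alternating_total_def)

lemma alternating_total_Suc:
  "alternating_total x y (Suc n) = c_elt * alternating_total x y n
     + (x * alternating_total y x n + x * alternating_total y x n)"
proof -
  \<comment> \<open>Removing the first letter exchanges the two exponent arguments of
    \<open>alternating\<close>, so the sum returns in reverse order.\<close>
  have reflect: "(\<Sum>i<n. alternating y x i (n - Suc i)) = (\<Sum>i<n. alternating y x (n - Suc i) i)"
    by (rule sum.reindex_bij_witness[of _ "\<lambda>i. n - Suc i" "\<lambda>i. n - Suc i"]) auto
  have "(\<Sum>i<Suc n. alternating x y i (n - i)) = x * c_elt ^ n + c_elt * (\<Sum>i<n. alternating x y i (n - Suc i))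
      + (x * (\<Sum>i<n. alternating y x i (n - Suc i)) + x * (\<Sum>i<n. alternating y x i (n - Suc i)))"
    unfolding reflect
    by (simp add: sum.lessThan_Suc_shift sum_distrib_left sum.distrib add.assoc del: sum.lessThan_Suc)
  then show ?thesis
    by (simp add: alternating_total_def sum.distrib algebra_simps del: sum.lessThan_Suc)
qed

text \<open>Summing over all words of a given length absorbs both reversals. The terms u and u*
  supply the two pure powers of c, the parts \<open>r = 1\<close> and \<open>r = 2\<close> of M the
  two kinds of alternating products, and the outer Sweedler sum the missing weight 2.\<close>

lemma interval2_c_power:
  "interval2 (c_elt ^ n) = alternating_total var_a var_b n + alternating_total var_b var_a n"
proof -
  \<comment> \<open>After one deletion the two pieces have total length n - 1, so the cutoff n + 1
    meets the bound of \<open>mix_of_word\<close>.\<close>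
  let ?m = "\<lambda>u v. mix_upto 1 (Suc n) u v + mix_upto 2 (Suc n) u v"
  have add: "biadditive ?m"
    using biadditive_mix_upto[of 1 "Suc n"] biadditive_mix_upto[of 2 "Suc n"]
    by (simp add: biadditive_def)
  have reflect: "(\<Sum>i<n. alternating var_b var_a (n - Suc i) i) = (\<Sum>i<n. alternating var_b var_a i (n - Suc i))"
    by (rule sum.reindex_bij_witness[of _ "\<lambda>i. n - Suc i" "\<lambda>i. n - Suc i"]) auto
  have "interval2 (c_elt ^ n) = (\<Sum>w\<in>words n. of_word w + of_word (rev w)
      + (\<Sum>i<length w. mix (of_word (rev (take i w))) (of_word (drop (Suc i) w))))"
    by (simp add: interval2_def c_power_eq_sum_words lin_ext_sum lin_ext_of_word sweedler_of_word
        star_of_word)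
  also have "\<dots> = c_elt ^ n + c_elt ^ n + (\<Sum>w\<in>words n. \<Sum>i<length w.
      ?m (of_word (rev (take i w))) (of_word (drop (Suc i) w)))"
  proof -
    have "(\<Sum>i<length w. mix (of_word (rev (take i w))) (of_word (drop (Suc i) w))) =
        (\<Sum>i<length w. ?m (of_word (rev (take i w))) (of_word (drop (Suc i) w)))" if "w \<in> words n" for w
      using that by (intro sum.cong refl mix_of_word) (auto simp: words_def)
    then show ?thesis
      by (simp add: sum.distrib sum_words_rev[of of_word] c_power_eq_sum_words)
  qed
  also have "(\<Sum>w\<in>words n. \<Sum>i<length w. ?m (of_word (rev (take i w))) (of_word (drop (Suc i) w))) =
      (\<Sum>i<n. ?m (c_elt ^ i) (c_elt ^ (n - Suc i)) + ?m (c_elt ^ i) (c_elt ^ (n - Suc i)))"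
    unfolding sum_words_deletion[of "\<lambda>x y. ?m (of_word (rev x)) (of_word y)"]
      sum_words_rev[of "\<lambda>x. \<Sum>y\<in>words _. ?m (of_word x) (of_word y)"]
      biadditive_c_power[OF add] ..
  also have "\<dots> = (\<Sum>i<n. (alternating var_a var_b i (n - Suc i) + alternating var_b var_a (n - Suc i) i)
      + (alternating var_a var_b i (n - Suc i) + alternating var_b var_a (n - Suc i) i))"
    by (rule sum.cong) (simp_all add: mix_upto_c_power del: One_nat_def)
  finally show ?thesis
    by (simp add: alternating_total_def sum.distrib reflect algebra_simps)
qed

text \<open>Let e = a - b and let A, B be the degree n parts of P, Q. In degree n + 1, Q - P equals
  -e(A + B), which eliminates the difference in degree n + 2; then e^2 = c^2 - 2d gives the
  recurrence.\<close>

lemma cd_eval_cd_index: "cd_eval (cd_index n) = interval2 (c_elt ^ n)"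
  unfolding interval2_c_power
proof (induction n rule: cd_index.induct)
  case 1
  show ?case using cd_eval_scalar[of 2] by (simp add: alternating_total_0)
next
  case 2
  have "c_elt * 4 = c_elt + c_elt + (c_elt + c_elt)"
    using distrib_left[of c_elt 2 2] by (simp flip: mult_2_right)
  then show ?case
    using cd_eval_scalar[of 4]
    by (simp add: cd_eval_of_word_mult alternating_total_0 alternating_total_Suc) (simp add: c_elt_def)
next
  case (3 n)
  then show ?case
    by (simp add: cd_eval_of_word_mult cd_eval_add cd_eval_diff alternating_total_Suc)
      (simp add: c_elt_def d_elt_def algebra_simps)
qed

theorem theorem7p9:
  fixes n r :: nat and k :: "nat \<Rightarrow> nat"
  assumes "2 * r + (\<Sum>i\<le>r. k i) = n"
  shows "(\<exists>!\<Phi>. cd_eval \<Phi> = interval2 (c_elt ^ n)) \<and>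
    (\<forall>\<Phi>. cd_eval \<Phi> = interval2 (c_elt ^ n) \<longrightarrow>
      Poly_Mapping.lookup \<Phi> (cd_word r k) = 2 ^ (r + 1) * (\<Prod>i\<le>r. of_nat (k i + 1)))"
  \<comment> \<open>The witness is \<open>cd_index n\<close>, and injectivity of
    \<open>cd_eval\<close> makes it the only one.\<close>
  using lookup_cd_index[OF assms]
  by (auto simp: cd_eval_inject simp flip: cd_eval_cd_index)

end
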